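(* Let $d\ge1$. Assume that the sampling sets are quasi-uniform, i.e. $\delta_m\le C_0\gamma_m$ for all $m$ with $C_0$ independent of $m$, and that the weights satisfy $0<w_j\le C_1\delta_m^{d}$ for all $1\le j\le m$ with $C_1$ independent of $m$ and $j$. Assume that for some $L>d+1$ there is a constant $C_L$ independent of $n$ such that $$|\Phi_n(x,y)|\le C_L\,n^{d}\,(1+n\rho(x,y))^{-L}\qquad\text{for all }x,y\in\mathbb S^d,\ n\ge1 .$$ Let $C_2>0$. Then there is a constant $C>0$, independent of $m$, $n$ and $f$, such that $$\|\mathcal F_nf\|_{L^\infty}\le C\,\|f\|_{L^\infty}$$ for all $f\in C(\mathbb S^d)$ and all $m$ and $n\ge1$ with $n\le C_2\,\delta_m^{-1}$.
   Context: $\mathbb S^d=\{x\in\mathbb R^{d+1}:|x|=1\}$ carries the normalized surface measure $\sigma$ and the geodesic distance $\rho(x,y)=\arccos(x\cdot y)$. For each $\ell\ge0$, $\{Y_{\ell,k}:1\le k\le Z(d,\ell)\}$ is an $L^2(\mathbb S^d,\sigma)$-orthonormal basis of the (real) spherical harmonics of degree $\ell$, and $\lambda_\ell=\ell(\ell+d-1)$. Sampling: for each $m$ (in an infinite set of integers $m\ge2$) there are a point set $\mathcal X_m=\{x_j\}_{j=1}^m\subset\mathbb S^d$ and weights $w_j>0$ with $\sum_{j=1}^m w_j=1$ (points and weights may depend on $m$). The mesh norm is $\delta_m=\sup_{x\in\mathbb S^d}\min_{j}\rho(x,x_j)$ and the separation radius is $\gamma_m=\tfrac12\min_{i\ne j}\rho(x_i,x_j)$.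 For $n\ge1$ let $\eta_n:[0,\infty)\to\mathbb R$ be a spectral multiplier with kernel $\Phi_n(x,y)=\sum_{\ell\ge0}\eta_n(\lambda_\ell)\sum_kY_{\ell,k}(x)Y_{\ell,k}(y)$ (assumed to be a pointwise defined function), and define $\mathcal F_nf(x)=\sum_{j=1}^mw_jf(x_j)\Phi_n(x,x_j)$, which depends on both $m$ and $n$. *)

theory Defs
  imports "HOL-Analysis.Analysis" "HOL-Probability.Essential_Supremum"
begin

text \<open>The sphere \<open>S\<^sup>d\<close> is \<^term>\<open>sphere 0 1\<close> in a Euclidean space of dimension \<open>d + 1\<close>.
  Functions on the sphere are represented by functions on the whole space; only their values
  on the sphere matter.\<close>

definition geodist :: "'a::euclidean_space \<Rightarrow> 'a \<Rightarrow> real" where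
  "geodist x y = arccos (x \<bullet> y)"

text \<open>Normalized surface measure as normalized cone measure: \<open>\<sigma> A\<close> is the volume of
  \<open>{t x | x \<in> A, 0 < t < 1}\<close> divided by the volume of the unit ball. The function \<^const>\<open>sgn\<close> is
  the radial projection \<open>x / norm x\<close>; its value \<open>0\<close> at the origin concerns a null set only.\<close>

definition surface_measure :: "'a::euclidean_space measure" where
  "surface_measure =
     restrict_space (distr (uniform_measure lborel (ball 0 1)) borel sgn) (sphere 0 1)"

text \<open>The supremum norm is the essential one with respect to \<open>\<sigma>\<close>; it is \<open>\<infinity>\<close> on functions that
  are not Borel measurable on the sphere.\<close>

definition Linf_norm :: "('a::euclidean_space \<Rightarrow> real) \<Rightarrow> ereal" where
  "Linf_norm g = esssup surface_measure (\<lambda>x. ereal \<bar>g x\<bar>)"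

definition laplacian :: "('a::euclidean_space \<Rightarrow> real) \<Rightarrow> 'a \<Rightarrow> real" where
  "laplacian p x = (\<Sum>b\<in>Basis. (deriv ^^ 2) (\<lambda>t::real. p (x + t *\<^sub>R b)) 0)"

text \<open>Restrictions to the sphere of homogeneous harmonic polynomials of degree \<open>l\<close>.\<close>

definition spherical_harmonic :: "nat \<Rightarrow> ('a::euclidean_space \<Rightarrow> real) \<Rightarrow> bool" where
  "spherical_harmonic l f \<longleftrightarrow>
     (\<exists>p. real_polynomial_function p \<and>
          (\<forall>t x. p (t *\<^sub>R x) = t ^ l * p x) \<and>
          (\<forall>x. laplacian p x = 0) \<and>
          (\<forall>x\<in>sphere 0 1. f x = p x))"

text \<open>\<open>Y 1, \<dots>, Y N\<close> is an orthonormal basis of the spherical harmonics of degree \<open>l\<close>. Hence \<open>N\<close> is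
  necessarily the dimension \<open>Z(d,l)\<close> of that space.\<close>

definition harmonic_onb :: "nat \<Rightarrow> nat \<Rightarrow> (nat \<Rightarrow> 'a::euclidean_space \<Rightarrow> real) \<Rightarrow> bool" where
  "harmonic_onb l N Y \<longleftrightarrow>
     (\<forall>k\<in>{1..N}. spherical_harmonic l (Y k)) \<and>
     (\<forall>j\<in>{1..N}. \<forall>k\<in>{1..N}.
        (LINT x|surface_measure. Y j x * Y k x) = (if j = k then 1 else 0)) \<and>
     (\<forall>g. spherical_harmonic l g \<longrightarrow>
        (\<exists>c. \<forall>x\<in>sphere 0 1. g x = (\<Sum>k=1..N. c k * Y k x)))"

definition eigval :: "nat \<Rightarrow> nat \<Rightarrow> real" where
  "eigval d l = real l * (real l + real d - 1)"

definition kernel_term ::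
  "nat \<Rightarrow> (nat \<Rightarrow> nat) \<Rightarrow> (nat \<Rightarrow> nat \<Rightarrow> 'a::euclidean_space \<Rightarrow> real) \<Rightarrow> (real \<Rightarrow> real) \<Rightarrow>
     'a \<Rightarrow> 'a \<Rightarrow> nat \<Rightarrow> real" where
  "kernel_term d Z Y h x y l = h (eigval d l) * (\<Sum>k=1..Z l. Y l k x * Y l k y)"

text \<open>Meaningful where the series converges. Convergence is that of the partial sums in the
  order of the degree, not absolute convergence.\<close>

definition spectral_kernel ::
  "nat \<Rightarrow> (nat \<Rightarrow> nat) \<Rightarrow> (nat \<Rightarrow> nat \<Rightarrow> 'a::euclidean_space \<Rightarrow> real) \<Rightarrow> (real \<Rightarrow> real) \<Rightarrow>
     'a \<Rightarrow> 'a \<Rightarrow> real" where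
  "spectral_kernel d Z Y h x y = (\<Sum>l. kernel_term d Z Y h x y l)"

definition mesh_norm :: "nat \<Rightarrow> (nat \<Rightarrow> 'a::euclidean_space) \<Rightarrow> real" where
  "mesh_norm m X = (SUP x\<in>sphere 0 1. Min ((\<lambda>j. geodist x (X j)) ` {1..m}))"

definition separation_radius :: "nat \<Rightarrow> (nat \<Rightarrow> 'a::euclidean_space) \<Rightarrow> real" where
  "separation_radius m X =
     1 / 2 * Min {geodist (X i) (X j) | i j. i \<in> {1..m} \<and> j \<in> {1..m} \<and> i \<noteq> j}"

definition filtered_op ::
  "nat \<Rightarrow> (nat \<Rightarrow> 'a::euclidean_space) \<Rightarrow> (nat \<Rightarrow> real) \<Rightarrow> ('a \<Rightarrow> 'a \<Rightarrow> real) \<Rightarrow>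
     ('a \<Rightarrow> real) \<Rightarrow> 'a \<Rightarrow> real" where
  "filtered_op m X w K f x = (\<Sum>j=1..m. w j * f (X j) * K x (X j))"

end

theory Submission
  imports Defs
begin

text \<open>The essential supremum of a continuous function dominates each of its values, because
  \<open>\<sigma>\<close> charges every nonempty relatively open set. So it suffices to bound
  \<open>\<Sum>j. w\<^sub>j \<bar>\<Phi>\<^sub>n(x, x\<^sub>j)\<bar>\<close> uniformly in \<open>x\<close>, \<open>m\<close> and \<open>n\<close>. Splitting the nodes into the shells
  \<open>k \<le> n \<rho>(x, x\<^sub>j) < k + 1\<close>, each of which contains at most \<open>8 (8 (k + 1) / (n \<gamma>) + 1)\<^sup>d\<close> nodes, the
  sum is at most a constant times \<open>(n \<delta>)\<^sup>d (1 + 1 / (n \<gamma>))\<^sup>d \<Sum>k. (k + 1)\<^bsup>d - L\<^esup>\<close>. This is bounded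
  because \<open>n \<delta> \<le> C\<^sub>2\<close> and \<open>\<delta> / \<gamma> \<le> C\<^sub>0\<close>.

  The count of nodes in a spherical cap has exponent \<open>d\<close>, not \<open>d + 1\<close>. It is obtained from the
  volume bound for packings in the ambient space by adding to each node \<open>p\<close> its dilates
  \<open>(1 + k s) p\<close>, \<open>k \<le> r / s\<close>, where \<open>s\<close> is the separation and \<open>r\<close> the radius of the cap.\<close>

section \<open>Packing bounds in space and on the sphere\<close>

text \<open>Volume comparison: the balls of radius \<open>s/2\<close> about the points of
  \<open>S\<close> are disjoint and lie in the ball of radius \<open>R + s/2\<close> about
  \<open>x\<close>.\<close>

lemma card_separated_le:
  fixes S :: "'a::euclidean_space set"
  assumes "finite S" "S \<subseteq> cball x R" "s > 0" "R \<ge> 0"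
    and sep: "\<And>p q. p \<in> S \<Longrightarrow> q \<in> S \<Longrightarrow> p \<noteq> q \<Longrightarrow> s \<le> dist p q"
  shows "real (card S) \<le> (2 * R / s + 1) ^ DIM('a)"
proof -
  let ?D = "DIM('a)"
  define v where "v = unit_ball_vol (real ?D)"
  have v: "v > 0" unfolding v_def by simp
  have fm: "ball p e \<in> fmeasurable lborel" for p :: 'a and e
    by (rule fmeasurableI) (use emeasure_bounded_finite[of "ball p e"] in auto)
  have disj: "pairwise (\<lambda>p q. disjnt (ball p (s/2)) (ball q (s/2))) S"
    unfolding pairwise_def disjnt_def
  proof (intro ballI impI)
    fix p q assume "p \<in> S" "q \<in> S" "p \<noteq> q"
    then have "s \<le> dist p q" by (rule sep)
    then show "ball p (s/2) \<inter> ball q (s/2) = {}"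
      by (intro disjoint_ballI) simp
  qed
  have "real (card S) * (v * (s/2) ^ ?D) = (\<Sum>p\<in>S. measure lborel (ball p (s/2)))"
    using \<open>s > 0\<close> by (simp add: content_ball v_def)
  also have "\<dots> = measure lborel (\<Union>p\<in>S. ball p (s/2))"
    by (rule measure_UNION'[symmetric]) (use assms(1) fm disj in auto)
  also have "\<dots> \<le> measure lborel (ball x (R + s/2))"
  proof (rule measure_mono_fmeasurable)
    show "(\<Union>p\<in>S. ball p (s/2)) \<subseteq> ball x (R + s/2)"
    proof safe
      fix p y assume "p \<in> S" "y \<in> ball p (s/2)"
      with \<open>S \<subseteq> cball x R\<close> have "dist x p \<le> R" "dist p y < s/2" by auto
      with dist_triangle[of x y p] show "y \<in> ball x (R + s/2)" by simp
    qed
  qed (use fm assms(1) in \<open>auto intro!: sets.finite_UN\<close>)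
  also have "\<dots> = v * (R + s/2) ^ ?D"
    using assms by (simp add: content_ball v_def)
  finally have "real (card S) * (s/2) ^ ?D \<le> (R + s/2) ^ ?D"
    using v by (simp add: mult.left_commute[of _ v])
  also have "R + s/2 = (2 * R / s + 1) * (s/2)"
    using \<open>s > 0\<close> by (simp add: field_simps)
  finally have "real (card S) * (s/2) ^ ?D \<le> (2 * R / s + 1) ^ ?D * (s/2) ^ ?D"
    by (simp only: power_mult_distrib)
  then show ?thesis
    by (rule mult_right_le_imp_le) (use \<open>s > 0\<close> in simp)
qed

text \<open>The squared distances differ by
  \<open>(a - b)\<^sup>2 + 2 * (a * b - 1) * (1 - p \<bullet> q)\<close>, in which no term is
  negative.\<close>

lemma dist_scaleR_unit_ge:
  fixes p q :: "'a::real_inner"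
  assumes "norm p = 1" "norm q = 1" "a \<ge> 1" "b \<ge> 1"
  shows "dist p q \<le> dist (a *\<^sub>R p) (b *\<^sub>R q)"
proof -
  have pp: "p \<bullet> p = 1" "q \<bullet> q = 1"
    using assms by (simp_all add: norm_eq_1)
  have "p \<bullet> q \<le> 1"
    using norm_cauchy_schwarz[of p q] assms by simp
  moreover have "a * b \<ge> 1"
    using mult_mono[of 1 a 1 b] assms by simp
  ultimately have "0 \<le> (a - b)\<^sup>2 + 2 * ((a * b - 1) * (1 - p \<bullet> q))"
    by simp
  moreover have "(dist p q)\<^sup>2 = 2 - 2 * (p \<bullet> q)"
    by (simp add: dist_norm power2_norm_eq_inner inner_diff pp inner_commute)
  moreover have "(dist (a *\<^sub>R p) (b *\<^sub>R q))\<^sup>2 = a\<^sup>2 + b\<^sup>2 - 2 * (a * b) * (p \<bullet> q)"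
    by (simp add: dist_norm power2_norm_eq_inner inner_diff pp inner_commute)
       (simp add: power2_eq_square)
  ultimately have "(dist p q)\<^sup>2 \<le> (dist (a *\<^sub>R p) (b *\<^sub>R q))\<^sup>2"
    by (simp add: algebra_simps power2_eq_square)
  then show ?thesis
    by (rule power2_le_imp_le) simp
qed

text \<open>One of the \<open>d + 1\<close> powers in the ambient packing bound is spent on the
  radial direction: each point of \<open>T\<close> is replaced by \<open>N + 1\<close> points on its
  ray, and dividing by \<open>N + 1\<close> leaves the power \<open>d\<close>.\<close>

lemma card_separated_sphere_le:
  fixes T :: "'a::euclidean_space set"
  assumes "finite T" "T \<subseteq> sphere 0 1" "T \<subseteq> cball x r" "norm x = 1" "s > 0" "r \<ge> 0"
    and D: "DIM('a) = d + 1"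
    and sep: "\<And>p q. p \<in> T \<Longrightarrow> q \<in> T \<Longrightarrow> p \<noteq> q \<Longrightarrow> s \<le> dist p q"
  shows "real (card T) \<le> 8 * (4 * r / s + 1) ^ d"
proof -
  \<comment> \<open>This is the largest \<open>N\<close> with \<open>N * s \<le> r\<close>: each
    dilate stays within \<open>r\<close> of its point, yet there are more than \<open>r / s\<close>
    dilates per point.\<close>
  define N where "N = nat \<lfloor>r / s\<rfloor>"
  have rs: "r / s \<ge> 0" using assms by simp
  have N: "real N \<le> r / s" "r / s < real N + 1"
    using rs unfolding N_def by linarith+
  define g where "g = (\<lambda>(k::nat, p::'a). (1 + real k * s) *\<^sub>R p)"
  define S where "S = g ` ({..N} \<times> T)"
  have unit: "norm p = 1" if "p \<in> T" for p
    using that assms(2) by auto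
  \<comment> \<open>On different rays, dilation by factors at least 1 does not reduce the distance;
    on one ray, the dilates are spaced by multiples of \<open>s\<close>.\<close>
  have gsep: "s \<le> dist (g u) (g u')"
    if uu: "u \<in> {..N} \<times> T" "u' \<in> {..N} \<times> T" "u \<noteq> u'" for u u'
  proof -
    obtain k p k' p' where u: "u = (k, p)" "u' = (k', p')" by fastforce
    have p: "p \<in> T" "p' \<in> T" using uu u by auto
    show ?thesis
    proof (cases "p = p'")
      case False
      have "s \<le> dist p p'" using sep p False by blast
      also have "\<dots> \<le> dist ((1 + real k * s) *\<^sub>R p) ((1 + real k' * s) *\<^sub>R p')"
        by (rule dist_scaleR_unit_ge) (use p unit \<open>s > 0\<close> in auto)
      finally show ?thesis by (simp add: u g_def)
    next
      case True
      have "k \<noteq> k'" using uu u True by auto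
      then have "1 \<le> \<bar>real k - real k'\<bar>" by linarith
      then have "s \<le> \<bar>real k - real k'\<bar> * s" using \<open>s > 0\<close> by simp
      also have "\<dots> = dist (g u) (g u')"
        using \<open>s > 0\<close> p unit
        by (simp add: u g_def True dist_norm abs_mult
            flip: scaleR_left_diff_distrib left_diff_distrib)
      finally show ?thesis .
    qed
  qed
  have inj: "inj_on g ({..N} \<times> T)"
  proof (rule inj_onI, rule ccontr)
    fix u u' assume "u \<in> {..N} \<times> T" "u' \<in> {..N} \<times> T" "g u = g u'" "u \<noteq> u'"
    with gsep[of u u'] \<open>s > 0\<close> show False by simp
  qed
  have "real (N + 1) * real (card T) = real (card S)"
    by (simp add: S_def card_image inj card_cartesian_product algebra_simps)
  also have "\<dots> \<le> (2 * (2 * r) / s + 1) ^ DIM('a)"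
  proof (rule card_separated_le)
    show "S \<subseteq> cball x (2 * r)"
    proof
      fix y assume "y \<in> S"
      then obtain k p where kp: "k \<le> N" "p \<in> T" "y = (1 + real k * s) *\<^sub>R p"
        by (auto simp: S_def g_def)
      have "real k * s \<le> real N * s" using kp \<open>s > 0\<close> by simp
      also have "\<dots> \<le> r" using N(1) \<open>s > 0\<close> by (simp add: field_simps)
      finally have "real k * s \<le> r" .
      moreover have "dist x p \<le> r" using kp assms by auto
      moreover have "dist p y = real k * s"
        using kp unit \<open>s > 0\<close> by (simp add: dist_norm algebra_simps)
      ultimately show "y \<in> cball x (2 * r)"
        using dist_triangle[of x y p] by simp
    qed
    show "s \<le> dist p q" if "p \<in> S" "q \<in> S" "p \<noteq> q" for p q
      using that gsep unfolding S_def by blast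
  qed (use assms in \<open>auto simp: S_def\<close>)
  also have "\<dots> = (4 * r / s + 1) ^ d * (4 * r / s + 1)"
    by (simp add: D)
  \<comment> \<open>Since \<open>r / s < N + 1\<close>, one factor is absorbed into the number of
    dilates, which then cancels.\<close>
  also have "\<dots> \<le> (4 * r / s + 1) ^ d * (8 * real (N + 1))"
    using N(2) rs by (intro mult_left_mono) auto
  also have "\<dots> = real (N + 1) * (8 * (4 * r / s + 1) ^ d)"
    by (simp only: mult_ac)
  finally show ?thesis
    by (rule mult_left_le_imp_le) simp
qed

section \<open>Geodesic and chordal distance\<close>

text \<open>Taylor's formula gives \<open>sin t \<ge> t - t ^ 3 / 6\<close>, and
  \<open>t\<^sup>2 \<le> 4\<close> turns this into \<open>t / 3\<close>. The range up to 2 covers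
  half of any geodesic distance, as \<open>pi / 2 < 2\<close>.\<close>

lemma sin_ge_third:
  fixes t :: real
  assumes "0 \<le> t" "t \<le> 2"
  shows "t / 3 \<le> sin t"
proof -
  have "\<bar>sin t - (\<Sum>m<3. sin_coeff m * t ^ m)\<bar> \<le> inverse (fact 3) * \<bar>t\<bar> ^ 3"
    by (rule Maclaurin_sin_bound)
  then have "\<bar>sin t - t\<bar> \<le> t ^ 3 / 6"
    using assms by (simp add: eval_nat_numeral sin_coeff_def)
  then have "t - t ^ 3 / 6 \<le> sin t"
    by linarith
  moreover have "t * t ^ 2 \<le> t * 2 ^ 2"
    using assms by (intro mult_left_mono power_mono) auto
  ultimately show ?thesis
    by (simp add: power3_eq_cube power2_eq_square)
qed

text \<open>The chord has length \<open>2 * sin t\<close>, where \<open>t\<close> is half the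
  geodesic distance, so both comparisons reduce to \<open>t / 3 \<le> sin t \<le> t\<close>.\<close>

lemma
  fixes x y :: "'a::euclidean_space"
  assumes "norm x = 1" "norm y = 1"
  shows geodist_nonneg: "0 \<le> geodist x y"
    and dist_le_geodist: "dist x y \<le> geodist x y"
    and geodist_le_dist: "geodist x y \<le> 3 * dist x y"
proof -
  have c: "- 1 \<le> x \<bullet> y" "x \<bullet> y \<le> 1"
    using Cauchy_Schwarz_ineq2[of x y] assms by auto
  define t where "t = geodist x y / 2"
  have g: "0 \<le> geodist x y" "geodist x y \<le> pi"
    using arccos_bounded[OF c] by (auto simp: geodist_def)
  show "0 \<le> geodist x y" by (fact g)
  have cs: "cos (2 * t) = x \<bullet> y"
    using c by (simp add: t_def geodist_def)
  have "x \<bullet> x = 1" "y \<bullet> y = 1"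
    using assms by (simp_all add: norm_eq_1)
  then have "(dist x y)\<^sup>2 = 2 - 2 * cos (2 * t)"
    by (simp add: cs dist_norm power2_norm_eq_inner inner_diff inner_commute)
  also have "\<dots> = (2 * sin t)\<^sup>2"
    by (simp add: cos_double_sin power_mult_distrib)
  finally have "(dist x y)\<^sup>2 = (2 * sin t)\<^sup>2" .
  moreover have t: "0 \<le> t" "t \<le> 2"
    using g pi_less_4 by (auto simp: t_def)
  moreover have "0 \<le> 2 * sin t"
    using sin_ge_third[OF t] t by simp
  ultimately have "dist x y = 2 * sin t"
    using zero_le_dist power2_eq_imp_eq by blast
  then show "dist x y \<le> geodist x y" "geodist x y \<le> 3 * dist x y"
    using sin_x_le_x[of t] sin_ge_third[OF t] t by (auto simp: t_def)
qed

section \<open>Summation over shells\<close>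

text \<open>The shell with index \<open>k\<close> holds at most a constant times
  \<open>(k + 1) ^ d\<close> nodes, each contributing at most \<open>(k + 1) powr (- L)\<close>. The
  bound depends neither on \<open>x\<close> nor on the number of nodes; \<open>t\<close> will be the
  degree \<open>n\<close>.\<close>

lemma sum_geodist_powr_le:
  fixes x :: "'a::euclidean_space" and X :: "'b \<Rightarrow> 'a" and L :: real
  assumes D: "DIM('a) = d + 1" and L: "L > real d + 1" and "finite J"
    and x: "norm x = 1" and X: "\<And>j. j \<in> J \<Longrightarrow> norm (X j) = 1"
    and "\<gamma> > 0" and "t > 0"
    and sep: "\<And>i j. i \<in> J \<Longrightarrow> j \<in> J \<Longrightarrow> i \<noteq> j \<Longrightarrow> 2 * \<gamma> \<le> geodist (X i) (X j)"
  shows "(\<Sum>j\<in>J. (1 + t * geodist x (X j)) powr (- L))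
    \<le> 8 * (8 / (t * \<gamma>) + 1) ^ d * (\<Sum>k. real (Suc k) powr (real d - L))"
proof -
  define b where "b = 8 / (t * \<gamma>) + 1"
  define \<kappa> where "\<kappa> j = nat \<lfloor>t * geodist x (X j)\<rfloor>" for j
  have g0: "0 \<le> t * geodist x (X j)" if "j \<in> J" for j
    using geodist_nonneg[OF x X[OF that]] \<open>t > 0\<close> by simp
  have \<kappa>: "real (\<kappa> j) \<le> t * geodist x (X j)" "t * geodist x (X j) < real (\<kappa> j) + 1" if "j \<in> J" for j
    using g0[OF that] unfolding \<kappa>_def by linarith+
  \<comment> \<open>Here \<open>L > d + 1\<close> enters: the exponent \<open>d - L\<close> lies
    below -1.\<close>
  have summ: "summable (\<lambda>k. real (Suc k) powr (real d - L))"
    using L by (subst summable_Suc_iff) (simp add: summable_real_powr_iff)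
  have count: "real (card {j\<in>J. \<kappa> j = k}) \<le> 8 * b ^ d * real (Suc k) ^ d" for k
  proof -
    let ?A = "{j\<in>J. \<kappa> j = k}" and ?r = "real (Suc k) / t"
    \<comment> \<open>The chord is at least a third of the geodesic distance, hence at least
      \<open>2 * \<gamma> / 3\<close>; \<open>\<gamma> / 2\<close> keeps the constants
      simple.\<close>
    have sep': "\<gamma> / 2 \<le> dist (X i) (X j)" if "i \<in> J" "j \<in> J" "i \<noteq> j" for i j
      using sep[OF that] geodist_le_dist[of "X i" "X j"] X that \<open>\<gamma> > 0\<close> by simp
    have "inj_on X ?A"
    proof (rule inj_onI, rule ccontr)
      fix i j assume "i \<in> ?A" "j \<in> ?A" "X i = X j" "i \<noteq> j"
      with sep'[of i j] \<open>\<gamma> > 0\<close> show False by simp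
    qed
    then have "real (card ?A) = real (card (X ` ?A))"
      by (simp add: card_image)
    also have "\<dots> \<le> 8 * (4 * ?r / (\<gamma> / 2) + 1) ^ d"
    proof (rule card_separated_sphere_le)
      show "X ` ?A \<subseteq> cball x ?r"
      proof safe
        fix j assume "j \<in> J" "k = \<kappa> j"
        then have "t * geodist x (X j) \<le> real (Suc (\<kappa> j))" using \<kappa>(2)[of j] by simp
        then have "geodist x (X j) \<le> real (Suc (\<kappa> j)) / t"
          using \<open>t > 0\<close> by (simp add: field_simps)
        with dist_le_geodist[of x "X j"] x X \<open>j \<in> J\<close>
        show "X j \<in> cball x (real (Suc (\<kappa> j)) / t)" by simp
      qed
      show "\<gamma> / 2 \<le> dist p q" if "p \<in> X ` ?A" "q \<in> X ` ?A" "p \<noteq> q" for p q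
        using that sep' by blast
    qed (use assms in auto)
    \<comment> \<open>The base equals \<open>8 * (k + 1) / (t * \<gamma>) + 1\<close>; enlarging its
      last summand to \<open>k + 1\<close> separates the shell index from \<open>b\<close>.\<close>
    also have "\<dots> \<le> 8 * (b * real (Suc k)) ^ d"
      using \<open>t > 0\<close> \<open>\<gamma> > 0\<close>
      by (intro mult_left_mono power_mono) (auto simp: b_def field_simps)
    finally show ?thesis by (simp add: power_mult_distrib)
  qed
  have b: "b \<ge> 0" using \<open>t > 0\<close> \<open>\<gamma> > 0\<close> by (simp add: b_def)
  have "(\<Sum>j\<in>J. (1 + t * geodist x (X j)) powr (- L)) \<le> (\<Sum>j\<in>J. real (Suc (\<kappa> j)) powr (- L))"
    using \<kappa>(1) L by (intro sum_mono powr_mono2') auto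
  \<comment> \<open>The nodes are grouped by shell.\<close>
  also have "\<dots> = (\<Sum>k\<in>\<kappa> ` J. real (card {j\<in>J. \<kappa> j = k}) * real (Suc k) powr (- L))"
    using \<open>finite J\<close> by (subst sum_fun_comp[of J "\<kappa> ` J"]) auto
  also have "\<dots> \<le> (\<Sum>k\<in>\<kappa> ` J. 8 * b ^ d * real (Suc k) ^ d * real (Suc k) powr (- L))"
    by (intro sum_mono mult_right_mono count) auto
  also have "\<dots> = 8 * b ^ d * (\<Sum>k\<in>\<kappa> ` J. real (Suc k) powr (real d - L))"
    by (simp add: sum_distrib_left mult.assoc powr_diff powr_minus_divide powr_realpow
        del: of_nat_Suc)
  also have "\<dots> \<le> 8 * b ^ d * (\<Sum>k. real (Suc k) powr (real d - L))"
    using summ \<open>finite J\<close> b by (intro mult_left_mono sum_le_suminf) auto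
  finally show ?thesis by (simp add: b_def)
qed

section \<open>Surface measure and the essential supremum\<close>

lemma space_surface_measure [simp]: "space surface_measure = sphere 0 1"
  by (simp add: surface_measure_def space_restrict_space)

lemma sets_surface_measure:
  "sets (surface_measure :: 'a::euclidean_space measure) = sets (restrict_space borel (sphere 0 1))"
  by (simp add: surface_measure_def sets_restrict_space)

lemma borel_measurable_surface_continuous:
  fixes f :: "'a::euclidean_space \<Rightarrow> real"
  assumes "continuous_on (sphere 0 1) f"
  shows "f \<in> borel_measurable surface_measure"
  by (subst measurable_cong_sets[OF sets_surface_measure refl])
     (rule borel_measurable_continuous_on_restrict[OF assms])

text \<open>The part of the punctured unit ball that \<open>sgn\<close> maps into \<open>U\<close>
  is open and contains half of \<open>y\<close>, so it has positive volume. The origin is removed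
  because \<open>sgn\<close> is discontinuous there; it is not in the preimage of the sphere anyway,
  since \<open>sgn 0 = 0\<close>.\<close>

lemma emeasure_surface_open_pos:
  fixes U :: "'a::euclidean_space set"
  assumes "open U" and y: "y \<in> U" "norm y = 1"
  shows "emeasure surface_measure (U \<inter> sphere 0 1) > 0"
proof -
  let ?B = "ball 0 1 :: 'a set"
  let ?V = "(?B - {0}) \<inter> sgn -` U"
  have op: "open ?V"
    by (intro continuous_open_preimage continuous_intros) (use \<open>open U\<close> in auto)
  have "sgn ((1/2) *\<^sub>R y) = y"
    using y by (simp add: sgn_div_norm)
  with y have "(1/2) *\<^sub>R y \<in> ?V" by auto
  with op have "\<not> negligible ?V"
    using open_not_negligible by blast
  with op have pos: "emeasure lborel ?V \<noteq> 0"
    by (auto simp: negligible_iff_null_sets null_sets_def)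
  have Ub: "U \<inter> sphere 0 1 \<in> sets borel"
    using \<open>open U\<close> by auto
  have "emeasure surface_measure (U \<inter> sphere 0 1)
      = emeasure (distr (uniform_measure lborel ?B) borel sgn) (U \<inter> sphere 0 1)"
    unfolding surface_measure_def by (rule emeasure_restrict_space) auto
  also have "\<dots> = emeasure (uniform_measure lborel ?B) (sgn -` (U \<inter> sphere 0 1))"
    using Ub by (subst emeasure_distr) auto
  also have "\<dots> = emeasure lborel (?B \<inter> sgn -` (U \<inter> sphere 0 1)) / emeasure lborel ?B"
    using measurable_sets_borel[OF borel_measurable_sgn Ub]
    by (intro emeasure_uniform_measure) (simp_all del: vimage_Int)
  also have "?B \<inter> sgn -` (U \<inter> sphere 0 1) = ?V"
    by (auto simp: norm_sgn)
  also have "emeasure lborel ?V / emeasure lborel ?B > 0"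
    using pos emeasure_bounded_finite[of ?B]
    by (simp add: ennreal_zero_less_divide zero_less_iff_neq_zero)
  finally show ?thesis .
qed

text \<open>Otherwise the set where \<open>\<bar>f\<bar>\<close> exceeds its norm would be a
  nonempty relatively open set, hence of positive measure, whereas the essential supremum makes it
  null.\<close>

lemma abs_le_Linf_norm:
  fixes f :: "'a::euclidean_space \<Rightarrow> real"
  assumes cont: "continuous_on (sphere 0 1) f" and y: "norm y = 1"
  shows "ereal \<bar>f y\<bar> \<le> Linf_norm f"
proof (rule ccontr)
  assume less: "\<not> ?thesis"
  let ?N = "Linf_norm f"
  let ?A = "{x \<in> sphere 0 1. ?N < ereal \<bar>f x\<bar>}"
  have cont': "continuous_on (sphere 0 1) (\<lambda>x. ereal \<bar>f x\<bar>)"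
    by (intro continuous_intros cont)
  have eq: "(\<lambda>x. ereal \<bar>f x\<bar>) -` {?N<..} \<inter> sphere 0 1 = ?A"
    by blast
  obtain U where U: "open U" "U \<inter> sphere 0 1 = ?A"
    using iffD1[OF continuous_on_open_invariant cont', rule_format, OF open_greaterThan, of ?N]
    unfolding eq by blast
  have "y \<in> ?A" using less y by (simp add: not_le)
  then have "y \<in> U" using U(2) by blast
  then have "emeasure surface_measure ?A > 0"
    using emeasure_surface_open_pos[OF U(1) _ y] U(2) by simp
  moreover have "emeasure surface_measure ?A = 0"
    using esssup_zero_measure[of surface_measure "\<lambda>x. ereal \<bar>f x\<bar>"] by (simp add: Linf_norm_def)
  ultimately show False by simp
qed

section \<open>Measurability of the kernel\<close>

lemma spherical_harmonic_continuous_on: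
  fixes f :: "'a::euclidean_space \<Rightarrow> real"
  assumes "spherical_harmonic l f"
  shows "continuous_on (sphere 0 1) f"
proof -
  obtain p where "real_polynomial_function p" "\<And>x. x \<in> sphere 0 1 \<Longrightarrow> f x = p x"
    using assms unfolding spherical_harmonic_def by auto
  then show ?thesis
    by (metis continuous_at_imp_continuous_on continuous_on_cong continuous_real_polymonial_function)
qed

text \<open>Since \<open>Linf_norm\<close> is infinite on nonmeasurable functions, a pointwise bound
  on \<open>filtered_op\<close> yields a norm bound only together with measurability in
  \<open>x\<close>.\<close>

lemma spectral_kernel_measurable:
  fixes Y :: "nat \<Rightarrow> nat \<Rightarrow> 'a::euclidean_space \<Rightarrow> real"
  assumes "\<And>l. harmonic_onb l (Z l) (Y l)"
  shows "(\<lambda>x. spectral_kernel d Z Y h x y) \<in> borel_measurable surface_measure"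
  unfolding spectral_kernel_def kernel_term_def
proof (intro borel_measurable_suminf borel_measurable_times borel_measurable_const borel_measurable_sum)
  fix l k assume "k \<in> {1..Z l}"
  then have "spherical_harmonic l (Y l k)"
    using assms[of l] by (simp add: harmonic_onb_def)
  then show "Y l k \<in> borel_measurable surface_measure"
    by (intro borel_measurable_surface_continuous spherical_harmonic_continuous_on)
qed

section \<open>Separation radius\<close>

lemma finite_pair_distances:
  "finite {geodist (X i) (X j) | i j. i \<in> {1..m} \<and> j \<in> {1..m} \<and> i \<noteq> (j::nat)}"
  by (rule finite_subset[of _ "(\<lambda>(i, j). geodist (X i) (X j)) ` ({1..m} \<times> {1..m})"]) auto

lemma separation_radius_le:
  assumes "i \<in> {1..m}" "j \<in> {1..m}" "i \<noteq> j"
  shows "2 * separation_radius m X \<le> geodist (X i) (X j)"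
proof -
  let ?S = "{geodist (X i) (X j) | i j. i \<in> {1..m} \<and> j \<in> {1..m} \<and> i \<noteq> j}"
  have "Min ?S \<le> geodist (X i) (X j)"
    using assms by (intro Min_le finite_pair_distances) auto
  then show ?thesis
    by (simp add: separation_radius_def)
qed

lemma separation_radius_nonneg:
  fixes X :: "nat \<Rightarrow> 'a::euclidean_space"
  assumes "m \<ge> 2" "\<And>j. j \<in> {1..m} \<Longrightarrow> norm (X j) = 1"
  shows "separation_radius m X \<ge> 0"
proof -
  let ?S = "{geodist (X i) (X j) | i j. i \<in> {1..m} \<and> j \<in> {1..m} \<and> i \<noteq> j}"
  \<comment> \<open>Having at least two nodes makes the set nonempty, so that its \<open>Min\<close>
    is one of its elements.\<close>
  have "geodist (X 1) (X 2) \<in> ?S"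
    using assms(1) by force
  then have "Min ?S \<in> ?S"
    by (intro Min_in finite_pair_distances) auto
  then have "Min ?S \<ge> 0"
    using geodist_nonneg[OF assms(2) assms(2)] by auto
  then show ?thesis
    by (simp add: separation_radius_def)
qed

section \<open>From weighted kernel sums to the operator bound\<close>

text \<open>The value of \<open>f\<close> at each node is bounded by its norm, so a bound on the
  weighted kernel sums, uniform in \<open>x\<close>, bounds the operator.\<close>

lemma Linf_norm_filtered_op_le:
  fixes X :: "nat \<Rightarrow> 'a::euclidean_space"
  assumes X: "\<And>j. j \<in> {1..m} \<Longrightarrow> norm (X j) = 1" and "m \<ge> 1"
    and w: "\<And>j. j \<in> {1..m} \<Longrightarrow> w j \<ge> 0"
    and meas: "\<And>y. (\<lambda>x. K x y) \<in> borel_measurable surface_measure"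
    and K: "\<And>x. norm x = 1 \<Longrightarrow> (\<Sum>j=1..m. w j * \<bar>K x (X j)\<bar>) \<le> C"
    and "C > 0" and cont: "continuous_on (sphere 0 1) f"
  shows "Linf_norm (filtered_op m X w K f) \<le> ereal C * Linf_norm f"
proof (cases "Linf_norm f")
  case PInf
  then show ?thesis using \<open>C > 0\<close> by simp
next
  case (real B)
  have fB: "\<bar>f (X j)\<bar> \<le> B" if "j \<in> {1..m}" for j
    using abs_le_Linf_norm[OF cont X[OF that]] real by simp
  have "B \<ge> 0" using fB[of 1] \<open>m \<ge> 1\<close> by simp
  have bound: "\<bar>filtered_op m X w K f x\<bar> \<le> C * B" if "norm x = 1" for x
  proof -
    have "\<bar>filtered_op m X w K f x\<bar> \<le> (\<Sum>j=1..m. \<bar>w j * f (X j) * K x (X j)\<bar>)"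
      unfolding filtered_op_def by (rule sum_abs)
    also have "\<dots> \<le> (\<Sum>j=1..m. w j * \<bar>K x (X j)\<bar> * B)"
    proof (rule sum_mono)
      fix j assume j: "j \<in> {1..m}"
      have "w j * \<bar>K x (X j)\<bar> * \<bar>f (X j)\<bar> \<le> w j * \<bar>K x (X j)\<bar> * B"
        using fB[OF j] w[OF j] by (intro mult_left_mono) auto
      then show "\<bar>w j * f (X j) * K x (X j)\<bar> \<le> w j * \<bar>K x (X j)\<bar> * B"
        using w[OF j] by (simp add: abs_mult mult_ac)
    qed
    also have "\<dots> = (\<Sum>j=1..m. w j * \<bar>K x (X j)\<bar>) * B"
      by (simp add: sum_distrib_right)
    also have "\<dots> \<le> C * B"
      by (intro mult_right_mono K that \<open>B \<ge> 0\<close>)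
    finally show ?thesis .
  qed
  have "Linf_norm (filtered_op m X w K f) \<le> ereal (C * B)"
    unfolding Linf_norm_def
  proof (rule esssup_I)
    show "(\<lambda>x. ereal \<bar>filtered_op m X w K f x\<bar>) \<in> borel_measurable surface_measure"
      unfolding filtered_op_def
      by (intro borel_measurable_ereal borel_measurable_abs borel_measurable_sum
          borel_measurable_times borel_measurable_const meas)
    show "AE x in surface_measure. ereal \<bar>filtered_op m X w K f x\<bar> \<le> ereal (C * B)"
      by (rule AE_I2) (use bound in simp)
  qed
  then show ?thesis by (simp add: real)
next
  \<comment> \<open>Impossible: the norm dominates the nonnegative number
    \<open>\<bar>f (X 1)\<bar>\<close>.\<close>
  case MInf
  then show ?thesis
    using abs_le_Linf_norm[OF cont X[of 1]] \<open>m \<ge> 1\<close> by simp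
qed

theorem theorem3p7:
  fixes d :: nat
    and Z :: "nat \<Rightarrow> nat"
    and Y :: "nat \<Rightarrow> nat \<Rightarrow> 'a::euclidean_space \<Rightarrow> real"
    and M :: "nat set"
    and X :: "nat \<Rightarrow> nat \<Rightarrow> 'a"
    and w :: "nat \<Rightarrow> nat \<Rightarrow> real"
    and \<eta> :: "nat \<Rightarrow> real \<Rightarrow> real"
    and \<Phi> :: "nat \<Rightarrow> 'a \<Rightarrow> 'a \<Rightarrow> real"
    and C\<^sub>0 C\<^sub>1 C\<^sub>2 C\<^sub>L L :: real
  defines "\<Phi> \<equiv> \<lambda>n. spectral_kernel d Z Y (\<eta> n)"
  assumes "d \<ge> 1" and "DIM('a) = d + 1"
    and "\<And>l. harmonic_onb l (Z l) (Y l)"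
    and "infinite M" and "\<And>m. m \<in> M \<Longrightarrow> m \<ge> 2"
    and "\<And>m j. m \<in> M \<Longrightarrow> j \<in> {1..m} \<Longrightarrow> X m j \<in> sphere 0 1"
    and "\<And>m j. m \<in> M \<Longrightarrow> j \<in> {1..m} \<Longrightarrow> w m j > 0"
    and "\<And>m. m \<in> M \<Longrightarrow> (\<Sum>j=1..m. w m j) = 1"
    and "\<And>n x y. n \<ge> 1 \<Longrightarrow> x \<in> sphere 0 1 \<Longrightarrow> y \<in> sphere 0 1 \<Longrightarrow>
           summable (kernel_term d Z Y (\<eta> n) x y)"
    and "\<And>m. m \<in> M \<Longrightarrow> mesh_norm m (X m) \<le> C\<^sub>0 * separation_radius m (X m)"
    and "\<And>m j. m \<in> M \<Longrightarrow> j \<in> {1..m} \<Longrightarrow> w m j \<le> C\<^sub>1 * mesh_norm m (X m) ^ d"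
    and "L > real d + 1"
    and "\<And>n x y. n \<ge> 1 \<Longrightarrow> x \<in> sphere 0 1 \<Longrightarrow> y \<in> sphere 0 1 \<Longrightarrow>
           \<bar>\<Phi> n x y\<bar> \<le> C\<^sub>L * real n ^ d * (1 + real n * geodist x y) powr (- L)"
    and "C\<^sub>2 > 0"
  shows "\<exists>C>0. \<forall>m\<in>M. \<forall>n\<ge>1. real n \<le> C\<^sub>2 * inverse (mesh_norm m (X m)) \<longrightarrow>
           (\<forall>f. continuous_on (sphere 0 1) f \<longrightarrow>
              Linf_norm (filtered_op m (X m) (w m) (\<Phi> n) f) \<le> ereal C * Linf_norm f)"
proof -
  note D = assms(3) and onb = assms(4) and Xs = assms(7) and wpos = assms(8) and qu = assms(11)
    and wle = assms(12) and L = assms(13) and loc = assms(14)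
  define S where "S = (\<Sum>k. real (Suc k) powr (real d - L))"
  \<comment> \<open>The product collects the constants of the shell sum, the weights, the kernel and
    the bound \<open>nb\<close> below. Absolute values appear because the signs of
    \<open>C\<^sub>0\<close>, \<open>C\<^sub>1\<close> and \<open>C\<^sub>L\<close> are not
    prescribed; the summand 1 ensures positivity.\<close>
  define C where "C = 8 * \<bar>C\<^sub>1\<bar> * \<bar>C\<^sub>L\<bar> * (8 * \<bar>C\<^sub>0\<bar> + C\<^sub>2) ^ d * \<bar>S\<bar> + 1"
  have "C > 0"
    using \<open>C\<^sub>2 > 0\<close> unfolding C_def by (intro add_nonneg_pos mult_nonneg_nonneg) auto
  have op_bound: "Linf_norm (filtered_op m (X m) (w m) (\<Phi> n) f) \<le> ereal C * Linf_norm f"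
    if m: "m \<in> M" and n: "n \<ge> 1" and nle: "real n \<le> C\<^sub>2 * inverse (mesh_norm m (X m))"
      and cont: "continuous_on (sphere 0 1) f" for m n f
  proof (rule Linf_norm_filtered_op_le)
    let ?\<delta> = "mesh_norm m (X m)" and ?\<gamma> = "separation_radius m (X m)"
    have m2: "m \<ge> 2" using assms(6) m .
    have X1: "norm (X m j) = 1" if "j \<in> {1..m}" for j
      using Xs[OF m that] by simp
    \<comment> \<open>As \<open>inverse 0 = 0\<close>, the upper bound on \<open>n \<ge> 1\<close>
      already rules out a mesh norm that is zero or negative.\<close>
    have "0 < C\<^sub>2 * inverse ?\<delta>" using n nle by linarith
    then have \<delta>: "?\<delta> > 0"
      using \<open>C\<^sub>2 > 0\<close> by (simp add: zero_less_mult_iff)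
    have n\<delta>: "real n * ?\<delta> \<le> C\<^sub>2" using nle \<delta> by (simp add: field_simps)
    have \<gamma>0: "?\<gamma> \<ge> 0" using separation_radius_nonneg[of m "X m"] m2 X1 by simp
    have "?\<gamma> \<noteq> 0" using qu[OF m] \<delta> by auto
    with \<gamma>0 have \<gamma>: "?\<gamma> > 0" by simp
    have "?\<delta> \<le> \<bar>C\<^sub>0\<bar> * ?\<gamma>"
      using qu[OF m] \<gamma> by (meson abs_ge_self mult_right_mono order_trans \<gamma>0)
    then have \<delta>\<gamma>: "?\<delta> / ?\<gamma> \<le> \<bar>C\<^sub>0\<bar>" using \<gamma> by (simp add: field_simps)
    let ?b = "8 / (real n * ?\<gamma>) + 1"
    \<comment> \<open>The scales balance here: \<open>n\<close> cancels in the first term, leaving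
      the mesh ratio controlled by quasi-uniformity, and the second is at most
      \<open>C\<^sub>2\<close>.\<close>
    have "real n * ?\<delta> * ?b = 8 * (?\<delta> / ?\<gamma>) + real n * ?\<delta>"
      using n \<gamma> by (simp add: field_simps)
    also have "\<dots> \<le> 8 * \<bar>C\<^sub>0\<bar> + C\<^sub>2" using \<delta>\<gamma> n\<delta> by linarith
    finally have nb: "(real n * ?\<delta> * ?b) ^ d \<le> (8 * \<bar>C\<^sub>0\<bar> + C\<^sub>2) ^ d"
      using \<delta> \<gamma> by (intro power_mono) auto
    show "(\<Sum>j=1..m. w m j * \<bar>\<Phi> n x (X m j)\<bar>) \<le> C" if x: "norm x = 1" for x
    proof -
      let ?A = "\<bar>C\<^sub>1\<bar> * ?\<delta> ^ d * (\<bar>C\<^sub>L\<bar> * real n ^ d)"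
      have "(\<Sum>j=1..m. w m j * \<bar>\<Phi> n x (X m j)\<bar>)
          \<le> (\<Sum>j=1..m. ?A * (1 + real n * geodist x (X m j)) powr (- L))"
      proof (rule sum_mono)
        fix j assume j: "j \<in> {1..m}"
        have "w m j \<le> \<bar>C\<^sub>1\<bar> * ?\<delta> ^ d"
          using wle[OF m j] \<delta> by (meson abs_ge_self mult_right_mono order_trans zero_le_power less_imp_le)
        moreover have "\<bar>\<Phi> n x (X m j)\<bar> \<le> C\<^sub>L * real n ^ d * (1 + real n * geodist x (X m j)) powr (- L)"
          using loc[OF n _ Xs[OF m j], of x] x by simp
        then have "\<bar>\<Phi> n x (X m j)\<bar> \<le> \<bar>C\<^sub>L\<bar> * real n ^ d * (1 + real n * geodist x (X m j)) powr (- L)"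
          by (rule order_trans) (intro mult_right_mono abs_ge_self; simp)
        ultimately have "w m j * \<bar>\<Phi> n x (X m j)\<bar>
            \<le> (\<bar>C\<^sub>1\<bar> * ?\<delta> ^ d) * (\<bar>C\<^sub>L\<bar> * real n ^ d * (1 + real n * geodist x (X m j)) powr (- L))"
          using \<delta> by (intro mult_mono) auto
        then show "w m j * \<bar>\<Phi> n x (X m j)\<bar> \<le> ?A * (1 + real n * geodist x (X m j)) powr (- L)"
          by (simp add: mult.assoc)
      qed
      also have "\<dots> = ?A * (\<Sum>j=1..m. (1 + real n * geodist x (X m j)) powr (- L))"
        by (simp add: sum_distrib_left)
      also have "\<dots> \<le> ?A * (8 * ?b ^ d * S)"
        unfolding S_def
        using \<delta> n \<gamma> by (intro mult_left_mono sum_geodist_powr_le[OF D L _ x X1] separation_radius_le) auto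
      \<comment> \<open>The powers from the weights, the kernel and the node count merge into the
        single power bounded by \<open>nb\<close>.\<close>
      also have "\<dots> = 8 * \<bar>C\<^sub>1\<bar> * \<bar>C\<^sub>L\<bar> * (real n * ?\<delta> * ?b) ^ d * S"
        by (simp add: power_mult_distrib mult_ac)
      also have "\<dots> \<le> 8 * \<bar>C\<^sub>1\<bar> * \<bar>C\<^sub>L\<bar> * (real n * ?\<delta> * ?b) ^ d * \<bar>S\<bar>"
        using \<delta> \<gamma> by (intro mult_left_mono abs_ge_self mult_nonneg_nonneg zero_le_power) auto
      also have "\<dots> \<le> 8 * \<bar>C\<^sub>1\<bar> * \<bar>C\<^sub>L\<bar> * (8 * \<bar>C\<^sub>0\<bar> + C\<^sub>2) ^ d * \<bar>S\<bar>"
        using nb by (intro mult_left_mono mult_right_mono) auto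
      finally show ?thesis by (simp add: C_def)
    qed
    show "m \<ge> 1" using m2 by simp
    show "w m j \<ge> 0" if "j \<in> {1..m}" for j
      using wpos[OF m that] by simp
    show "(\<lambda>x. \<Phi> n x y) \<in> borel_measurable surface_measure" for y
      unfolding \<Phi>_def by (rule spectral_kernel_measurable[OF onb])
  qed (use Xs[OF m] cont \<open>C > 0\<close> in auto)
  show ?thesis
    using \<open>C > 0\<close> op_bound by blast
qed

end
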